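(* Let $n\ge 1$ and let $I_n=\{\sigma\in S_n:\sigma^2=\mathrm{id}\}$. The polynomial $$\mathcal{I}_n^{d,\mathrm{maj}}(t,q)=\sum_{\sigma\in I_n}t^{d(\sigma)}q^{\mathrm{maj}(\sigma)}$$ is symmetric in the sense that $[t^iq^j]\,\mathcal{I}_n^{d,\mathrm{maj}}(t,q)=[t^{n-1-i}q^{\binom n2-j}]\,\mathcal{I}_n^{d,\mathrm{maj}}(t,q)$ for all $0\le i\le n-1$ and $0\le j\le\binom n2$.
   Context: $S_n$ is the symmetric group on $\{1,\dots,n\}$, with $\sigma_i=\sigma(i)$. The descent set of $\sigma\in S_n$ is $\mathrm{Des}(\sigma)=\{i:1\le i<n,\ \sigma_i>\sigma_{i+1}\}$; $d(\sigma)=|\mathrm{Des}(\sigma)|$ is the number of descents; $\mathrm{maj}(\sigma)=\sum_{i\in\mathrm{Des}(\sigma)}i$ is the major index. $[t^iq^j]P(t,q)$ denotes the coefficient of $t^iq^j$ in $P(t,q)$. *)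

theory Defs
  imports
    "HOL-Combinatorics.Permutations"
    "HOL-Computational_Algebra.Polynomial"
begin

definition Des :: "nat \<Rightarrow> (nat \<Rightarrow> nat) \<Rightarrow> nat set" where
  "Des n \<sigma> = {i. 1 \<le> i \<and> i < n \<and> \<sigma> i > \<sigma> (i + 1)}"

definition des :: "nat \<Rightarrow> (nat \<Rightarrow> nat) \<Rightarrow> nat" where
  "des n \<sigma> = card (Des n \<sigma>)"

definition maj :: "nat \<Rightarrow> (nat \<Rightarrow> nat) \<Rightarrow> nat" where
  "maj n \<sigma> = (\<Sum>i\<in>Des n \<sigma>. i)"

definition involutions :: "nat \<Rightarrow> (nat \<Rightarrow> nat) set" where
  "involutions n = {\<sigma>. \<sigma> permutes {1..n} \<and> \<sigma> \<circ> \<sigma> = id}"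

(* Bivariate polynomials in t and q are polynomials in t over the ring of integer
   polynomials in q: the outer variable is t, the inner one is q. *)

definition var_t :: "int poly poly" where
  "var_t = [:0, 1:]"

definition var_q :: "int poly poly" where
  "var_q = [:[:0, 1:]:]"

definition coeff_tq :: "int poly poly \<Rightarrow> nat \<Rightarrow> nat \<Rightarrow> int" where
  "coeff_tq P i j = coeff (coeff P i) j"

definition inv_des_maj_poly :: "nat \<Rightarrow> int poly poly" where
  "inv_des_maj_poly n = (\<Sum>\<sigma>\<in>involutions n. var_t ^ des n \<sigma> * var_q ^ maj n \<sigma>)"

end

theory Submission
  imports Defs
begin

text \<open>
  The coefficient on the left counts involutions with \<open>i\<close> descents summing to \<open>j\<close>, and the one on
  the right counts involutions with \<open>i\<close> ascents summing to \<open>j\<close>, because ascents and descents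
  partition \<open>{1..<n}\<close>, a set of \<open>n - 1\<close> elements with sum \<open>n choose 2\<close>. So it suffices that
  descent sets and ascent sets are equidistributed on involutions. (The usual argument transposes
  the standard Young tableau that the Robinson--Schensted correspondence attaches to an involution;
  the proof below is elementary and does not use tableaux.)

  By inversion over the lattice of subsets (\<open>subset_sums_determine\<close>), it suffices to compare, for
  each set \<open>S\<close>, the involutions whose descents all lie in \<open>S\<close> with those whose ascents all lie in
  \<open>S\<close>. The set \<open>S\<close> cuts \<open>{1..n}\<close> into consecutive blocks, and the two conditions say that
  \<open>\<sigma>\<close> is increasing, respectively decreasing, on each block. In either case \<open>\<sigma>\<close> is determined by
  the symmetric matrix whose \<open>(k, l)\<close> entry is the number of points of block \<open>k\<close> that are sent to
  block \<open>l\<close>, and every symmetric matrix of natural numbers with the right row sums occurs.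
  Hence the two sets are equinumerous.

  The bijection that matches equal matrices can be written down directly. Given \<open>\<sigma>\<close>, the points of
  block \<open>k\<close> sent to block \<open>l\<close> form an interval. Let \<open>\<rho>\<close> reverse each of these intervals
  and let \<open>w\<close> reverse each block. Then \<open>\<rho>\<close> commutes with \<open>\<sigma>\<close>, so \<open>w \<circ> \<sigma> \<circ> \<rho> \<circ> w\<close> is again an
  involution; it is decreasing on blocks if \<open>\<sigma>\<close> is increasing on them, and vice versa
  (\<open>flip_involution\<close>, \<open>flip_monotone\<close>), and it determines \<open>\<sigma>\<close> (\<open>flip_inj\<close>).
\<close>

section \<open>Reversing the classes of an interval partition\<close>

definition convex_classes :: "nat \<Rightarrow> (nat \<Rightarrow> 'a) \<Rightarrow> bool" where
  "convex_classes n c \<longleftrightarrow> (\<forall>i j k. 1 \<le> i \<and> i < j \<and> j < k \<and> k \<le> n \<and> c i = c k \<longrightarrow> c j = c i)"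

definition class_rev :: "nat \<Rightarrow> (nat \<Rightarrow> 'a) \<Rightarrow> nat \<Rightarrow> nat" where
  "class_rev n c i =
     (if i \<in> {1..n}
      then Min {j \<in> {1..n}. c j = c i} + Max {j \<in> {1..n}. c j = c i} - i else i)"

lemma class_rev_outside: "i \<notin> {1..n} \<Longrightarrow> class_rev n c i = i"
  by (simp only: class_rev_def if_False)

lemma class_rev_mem:
  assumes "convex_classes n c" and "i \<in> {1..n}"
  shows "class_rev n c i \<in> {1..n}" and "c (class_rev n c i) = c i"
proof -
  let ?C = "{j \<in> {1..n}. c j = c i}"
  let ?r = "class_rev n c i"
  have fin: "finite ?C" and ne: "?C \<noteq> {}" using assms(2) by auto
  have m: "Min ?C \<in> ?C" and M: "Max ?C \<in> ?C"
    using Min_in[OF fin ne] Max_in[OF fin ne] by blast+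
  have "i \<in> ?C" using assms(2) by simp
  then have "Min ?C \<le> i" and "i \<le> Max ?C" using fin by simp_all
  moreover have "?r = Min ?C + Max ?C - i" using assms(2) by (simp only: class_rev_def if_True)
  ultimately have b: "Min ?C \<le> ?r" "?r \<le> Max ?C" by linarith+
  show "?r \<in> {1..n}" using b m M by auto
  show "c ?r = c i"
  proof (cases "?r = Min ?C \<or> ?r = Max ?C")
    case True
    then show ?thesis using m M by auto
  next
    case False
    then have "Min ?C < ?r" "?r < Max ?C" using b by linarith+
    moreover have "1 \<le> Min ?C" "Max ?C \<le> n" "c (Min ?C) = c (Max ?C)" "c (Min ?C) = c i"
      using m M by auto
    ultimately show ?thesis using assms(1) unfolding convex_classes_def by metis
  qed
qed

lemma class_rev_class:
  assumes "convex_classes n c"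
  shows "c (class_rev n c i) = c i"
proof (cases "i \<in> {1..n}")
  case True
  then show ?thesis by (rule class_rev_mem(2)[OF assms])
next
  case False
  then show ?thesis by (simp only: class_rev_outside not_False_eq_True)
qed

lemma class_rev_involutive:
  assumes "convex_classes n c"
  shows "class_rev n c (class_rev n c i) = i"
proof (cases "i \<in> {1..n}")
  case True
  let ?C = "{j \<in> {1..n}. c j = c i}"
  have "i \<in> ?C" "finite ?C" using True by simp_all
  then have "i \<le> Max ?C" by simp
  then show ?thesis
    using True class_rev_mem[OF assms True] by (auto simp: class_rev_def)
qed (simp only: class_rev_outside not_False_eq_True)

lemma class_rev_permutes:
  assumes "convex_classes n c"
  shows "class_rev n c permutes {1..n}"
  unfolding permutes_def
  using class_rev_involutive[OF assms] class_rev_outside by metis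

lemma class_rev_antimono:
  assumes "i \<in> {1..n}" "j \<in> {1..n}" "c i = c j" "i < j"
  shows "class_rev n c j < class_rev n c i"
proof -
  let ?C = "{k \<in> {1..n}. c k = c j}"
  have "j \<in> ?C" "finite ?C" using assms by simp_all
  then have "j \<le> Max ?C" by simp
  moreover have "class_rev n c j = Min ?C + Max ?C - j" "class_rev n c i = Min ?C + Max ?C - i"
    using assms(1-3) by (simp_all only: class_rev_def if_True)
  ultimately show ?thesis using assms(4) by linarith
qed

text \<open>
  The only order automorphism of a finite chain is the identity, here for all classes at once. A
  point moved down would be moved down again and again, so every point moves weakly up; as the sum
  of all points is preserved, no point moves.
\<close>
lemma class_increasing_permutation_id:
  fixes n :: nat
  assumes p: "p permutes {1..n}"
    and cls: "\<And>i. i \<in> {1..n} \<Longrightarrow> c (p i) = c i"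
    and inc: "\<And>i j. \<lbrakk>i \<in> {1..n}; j \<in> {1..n}; c i = c j; i < j\<rbrakk> \<Longrightarrow> p i < p j"
  shows "p = id"
proof
  fix x
  have up: "i \<in> {1..n} \<Longrightarrow> i \<le> p i" for i
  proof (induction i rule: less_induct)
    case (less i)
    have pi: "p i \<in> {1..n}" using p less.prems permutes_in_image by metis
    show ?case
    proof (rule ccontr)
      assume "\<not> i \<le> p i"
      then have lt: "p i < i" by simp
      have "p (p i) < p i" using inc[OF pi less.prems cls[OF less.prems] lt] .
      with less.IH[OF lt pi] show False by simp
    qed
  qed
  have "(\<Sum>i\<in>{1..n}. p i) = (\<Sum>i\<in>{1..n}. i)"
    using sum.permute[OF p, of "\<lambda>i. i"] by (simp add: comp_def)
  then have "\<forall>i\<in>{1..n}. i = p i"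
    using sum_mono_inv[of "\<lambda>i. i" "{1..n}" p] up by simp
  then show "p x = id x" using permutes_not_in[OF p] by (cases "x \<in> {1..n}") auto
qed

section \<open>Exchanging increasing and decreasing involutions on blocks\<close>

text \<open>
  The blocks are the level sets of \<open>b\<close>. The flag \<open>up\<close> selects the direction, so that both halves
  of the bijection are instances of one argument.
\<close>
definition block_monotone :: "nat \<Rightarrow> (nat \<Rightarrow> nat) \<Rightarrow> bool \<Rightarrow> (nat \<Rightarrow> nat) \<Rightarrow> bool" where
  "block_monotone n b up \<sigma> \<longleftrightarrow>
     (\<forall>i\<in>{1..n}. \<forall>j\<in>{1..n}. b i = b j \<and> i < j \<longrightarrow> (if up then \<sigma> i < \<sigma> j else \<sigma> j < \<sigma> i))"

definition block_pair :: "(nat \<Rightarrow> nat) \<Rightarrow> (nat \<Rightarrow> nat) \<Rightarrow> nat \<Rightarrow> nat \<times> nat" where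
  "block_pair b \<sigma> i = (b i, b (\<sigma> i))"

definition flip :: "nat \<Rightarrow> (nat \<Rightarrow> nat) \<Rightarrow> (nat \<Rightarrow> nat) \<Rightarrow> nat \<Rightarrow> nat" where
  "flip n b \<sigma> = class_rev n b \<circ> (\<sigma> \<circ> class_rev n (block_pair b \<sigma>)) \<circ> class_rev n b"

lemma involutionsD:
  assumes "\<sigma> \<in> involutions n"
  shows "\<sigma> permutes {1..n}" and "\<sigma> (\<sigma> i) = i"
  using assms by (simp_all add: involutions_def fun_eq_iff)

lemma convex_classes_mono: "mono b \<Longrightarrow> convex_classes n b" for b :: "nat \<Rightarrow> nat"
  unfolding convex_classes_def by (metis le_antisym less_imp_le monoD)

lemma convex_classes_block_pair:
  assumes b: "mono b" and \<sigma>: "block_monotone n b up \<sigma>"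
  shows "convex_classes n (block_pair b \<sigma>)"
  unfolding convex_classes_def
proof (intro allI impI)
  fix i j k
  assume h: "1 \<le> i \<and> i < j \<and> j < k \<and> k \<le> n \<and> block_pair b \<sigma> i = block_pair b \<sigma> k"
  then have ik: "b i = b k" "b (\<sigma> i) = b (\<sigma> k)" by (simp_all add: block_pair_def)
  have bj: "b j = b i" using convex_classes_mono[OF b, of n] h ik unfolding convex_classes_def by blast
  have "i \<in> {1..n}" "j \<in> {1..n}" "k \<in> {1..n}" using h by auto
  then have "(\<sigma> i \<le> \<sigma> j \<and> \<sigma> j \<le> \<sigma> k) \<or> (\<sigma> k \<le> \<sigma> j \<and> \<sigma> j \<le> \<sigma> i)"
    using \<sigma> h bj ik unfolding block_monotone_def by (metis less_imp_le)
  then have "b (\<sigma> j) = b (\<sigma> i)" using monoD[OF b] ik(2) by (metis le_antisym)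
  then show "block_pair b \<sigma> j = block_pair b \<sigma> i" using bj by (simp add: block_pair_def)
qed

text \<open>
  An involution exchanges the interval going from block \<open>k\<close> to block \<open>l\<close> with the one going from
  \<open>l\<close> to \<open>k\<close>, and does so monotonically; so it carries the reversal of the one to the
  reversal of the other.
\<close>
lemma class_rev_block_pair_commute:
  assumes b: "mono b" and inv: "\<sigma> \<in> involutions n" and \<sigma>: "block_monotone n b up \<sigma>"
  defines "\<rho> \<equiv> class_rev n (block_pair b \<sigma>)"
  shows "\<sigma> (\<rho> (\<sigma> (\<rho> i))) = i"
proof -
  let ?c = "block_pair b \<sigma>"
  note conv = convex_classes_block_pair[OF b \<sigma>]
  note perm = involutionsD(1)[OF inv] and ss = involutionsD(2)[OF inv]
  have \<rho>c: "?c (\<rho> i) = ?c i" for i unfolding \<rho>_def by (rule class_rev_class[OF conv])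
  have \<rho>p: "\<rho> permutes {1..n}" unfolding \<rho>_def by (rule class_rev_permutes[OF conv])
  have \<rho>in: "\<rho> i \<in> {1..n} \<longleftrightarrow> i \<in> {1..n}" for i using permutes_in_image[OF \<rho>p] .
  have \<sigma>in: "\<sigma> i \<in> {1..n} \<longleftrightarrow> i \<in> {1..n}" for i using permutes_in_image[OF perm] .
  have \<sigma>c: "?c (\<sigma> i) = prod.swap (?c i)" for i by (simp add: block_pair_def ss)
  have \<rho>less: "\<rho> j < \<rho> i" if "i \<in> {1..n}" "j \<in> {1..n}" "?c i = ?c j" "i < j" for i j
    unfolding \<rho>_def using that by (rule class_rev_antimono)
  have \<sigma>less: "if up then \<sigma> i < \<sigma> j else \<sigma> j < \<sigma> i"
    if "i \<in> {1..n}" "j \<in> {1..n}" "?c i = ?c j" "i < j" for i j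
    using that \<sigma> by (auto simp: block_monotone_def block_pair_def)
  define h where "h = \<sigma> \<circ> \<rho>"
  have hin: "h i \<in> {1..n} \<longleftrightarrow> i \<in> {1..n}" for i unfolding h_def comp_apply \<sigma>in \<rho>in ..
  have hc: "?c (h i) = prod.swap (?c i)" for i by (simp add: h_def \<sigma>c \<rho>c)
  have hless: "if up then h j < h i else h i < h j"
    if "i \<in> {1..n}" "j \<in> {1..n}" "?c i = ?c j" "i < j" for i j
  proof -
    have "\<rho> j \<in> {1..n}" "\<rho> i \<in> {1..n}" "?c (\<rho> j) = ?c (\<rho> i)"
      using that by (simp_all only: \<rho>in \<rho>c)
    from \<sigma>less[OF this \<rho>less[OF that]] show ?thesis by (simp only: h_def comp_apply)
  qed
  \<comment> \<open>\<open>h\<close> is monotone in one and the same direction on all classes, so \<open>h \<circ> h\<close> is increasing.\<close>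
  have "h \<circ> h = id"
  proof (rule class_increasing_permutation_id[where c = ?c])
    show "h \<circ> h permutes {1..n}"
      unfolding h_def by (intro permutes_compose \<rho>p perm)
    show "?c ((h \<circ> h) i) = ?c i" for i by (simp add: hc)
    fix i j assume ij: "i \<in> {1..n}" "j \<in> {1..n}" "?c i = ?c j" "i < j"
    show "(h \<circ> h) i < (h \<circ> h) j"
    proof -
      have h: "h i \<in> {1..n}" "h j \<in> {1..n}" using ij by (simp_all only: hin)
      have "?c (h i) = ?c (h j)" using ij(3) by (simp add: hc)
      from hless[OF ij] hless[OF h this] hless[OF h(2,1) this[symmetric]]
      show ?thesis by (cases up) (simp_all only: comp_apply if_True if_False)
    qed
  qed
  then show ?thesis unfolding h_def by (metis comp_apply id_apply)
qed

lemma flip_involution: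
  assumes b: "mono b" and inv: "\<sigma> \<in> involutions n" and \<sigma>: "block_monotone n b up \<sigma>"
  shows "flip n b \<sigma> \<in> involutions n"
proof -
  note wp = class_rev_permutes[OF convex_classes_mono[OF b], of n]
  note ww = class_rev_involutive[OF convex_classes_mono[OF b], of n]
  note \<rho>p = class_rev_permutes[OF convex_classes_block_pair[OF b \<sigma>]]
  have "flip n b \<sigma> permutes {1..n}"
    unfolding flip_def by (intro permutes_compose wp \<rho>p involutionsD(1)[OF inv])
  moreover have "flip n b \<sigma> \<circ> flip n b \<sigma> = id"
    by (simp add: fun_eq_iff flip_def ww class_rev_block_pair_commute[OF b inv \<sigma>])
  ultimately show ?thesis by (simp add: involutions_def)
qed

text \<open>
  Let \<open>i < j\<close> lie in one block. After \<open>w\<close> they are in the opposite order. If \<open>\<sigma>\<close> then sends them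
  to different blocks, neither \<open>\<rho>\<close> nor the outer \<open>w\<close> matters, and the order is reversed once;
  if it sends them to the same block, both reversals apply as well and the order is reversed three
  times.
\<close>
lemma flip_monotone:
  assumes b: "mono b" and inv: "\<sigma> \<in> involutions n" and \<sigma>: "block_monotone n b up \<sigma>"
  shows "block_monotone n b (\<not> up) (flip n b \<sigma>)"
  unfolding block_monotone_def
proof (intro ballI impI)
  fix i j assume ij: "i \<in> {1..n}" "j \<in> {1..n}" "b i = b j \<and> i < j"
  let ?c = "block_pair b \<sigma>"
  define w where "w = class_rev n b"
  define \<rho> where "\<rho> = class_rev n ?c"
  note cb = convex_classes_mono[OF b, of n]
  note cc = convex_classes_block_pair[OF b \<sigma>]
  have win: "w k \<in> {1..n} \<longleftrightarrow> k \<in> {1..n}" for k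
    unfolding w_def by (rule permutes_in_image[OF class_rev_permutes[OF cb]])
  have \<rho>in: "\<rho> k \<in> {1..n} \<longleftrightarrow> k \<in> {1..n}" for k
    unfolding \<rho>_def by (rule permutes_in_image[OF class_rev_permutes[OF cc]])
  have \<sigma>in: "\<sigma> k \<in> {1..n} \<longleftrightarrow> k \<in> {1..n}" for k
    by (rule permutes_in_image[OF involutionsD(1)[OF inv]])
  have wb: "b (w k) = b k" for k unfolding w_def by (rule class_rev_class[OF cb])
  have \<rho>c: "?c (\<rho> k) = ?c k" for k unfolding \<rho>_def by (rule class_rev_class[OF cc])
  have \<rho>b: "b (\<rho> k) = b k" "b (\<sigma> (\<rho> k)) = b (\<sigma> k)" for k
    using \<rho>c[of k] by (simp_all add: block_pair_def)
  have fl: "flip n b \<sigma> k = w (\<sigma> (\<rho> (w k)))" for k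
    by (simp add: flip_def w_def \<rho>_def)
  have bfl: "b (flip n b \<sigma> k) = b (\<sigma> (w k))" for k by (simp add: fl wb \<rho>b)
  have wji: "w j < w i" unfolding w_def using ij by (intro class_rev_antimono) auto
  have mon: "if up then \<sigma> k < \<sigma> l else \<sigma> l < \<sigma> k"
    if "k \<in> {1..n}" "l \<in> {1..n}" "b k = b l" "k < l" for k l
    using \<sigma> that unfolding block_monotone_def by blast
  have \<sigma>w: "if up then \<sigma> (w j) < \<sigma> (w i) else \<sigma> (w i) < \<sigma> (w j)"
    using mon[of "w j" "w i"] ij wji win wb by metis
  show "if \<not> up then flip n b \<sigma> i < flip n b \<sigma> j else flip n b \<sigma> j < flip n b \<sigma> i"
  proof (cases "b (\<sigma> (w i)) = b (\<sigma> (w j))")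
    case False
    have sep: "x < y" if "x' < y'" "b x = b x'" "b y = b y'" "b x \<noteq> b y" for x y x' y'
      using that b by (metis le_less_linear less_imp_le le_antisym monoD)
    show ?thesis
    proof (cases up)
      case True
      then show ?thesis
        using \<sigma>w sep[OF _ bfl bfl, of j i] bfl False by simp
    next
      case down: False
      then show ?thesis
        using \<sigma>w sep[OF _ bfl bfl, of i j] bfl False by simp
    qed
  next
    case True
    have wd: "w l < w k" if "k \<in> {1..n}" "l \<in> {1..n}" "b k = b l" "k < l" for k l
      unfolding w_def using that by (rule class_rev_antimono)
    have in_w: "w i \<in> {1..n}" "w j \<in> {1..n}" using ij by (simp_all only: win)
    have "?c (w j) = ?c (w i)" using True ij wb by (simp add: block_pair_def)
    from class_rev_antimono[OF in_w(2,1) this wji]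
    have \<rho>ij: "\<rho> (w i) < \<rho> (w j)" unfolding \<rho>_def .
    have in_\<rho>: "\<rho> (w i) \<in> {1..n}" "\<rho> (w j) \<in> {1..n}" using in_w by (simp_all only: \<rho>in)
    have b_\<rho>: "b (\<rho> (w i)) = b (\<rho> (w j))" using ij by (simp add: \<rho>b wb)
    have in_\<sigma>: "\<sigma> (\<rho> (w i)) \<in> {1..n}" "\<sigma> (\<rho> (w j)) \<in> {1..n}"
      using in_\<rho> by (simp_all only: \<sigma>in)
    have b_\<sigma>: "b (\<sigma> (\<rho> (w i))) = b (\<sigma> (\<rho> (w j)))" using True by (simp add: \<rho>b)
    show ?thesis
      using mon[OF in_\<rho> b_\<rho> \<rho>ij] wd[OF in_\<sigma> b_\<sigma>] wd[OF in_\<sigma>(2,1) b_\<sigma>[symmetric]]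
      by (cases up) (simp_all only: fl if_True if_False not_True_eq_False not_False_eq_True)
  qed
qed

text \<open>
  Since \<open>\<rho>\<close> preserves the pair of blocks of a point and of its image, \<open>\<sigma> \<circ> \<rho>\<close> already determines
  these pairs, hence \<open>\<rho>\<close>, hence \<open>\<sigma>\<close>.
\<close>
lemma flip_inj:
  assumes b: "mono b"
  shows "inj_on (flip n b) {\<sigma>. block_monotone n b up \<sigma>}"
proof (rule inj_onI)
  fix \<sigma> \<tau>
  assume eq: "flip n b \<sigma> = flip n b \<tau>"
    and "\<sigma> \<in> {\<sigma>. block_monotone n b up \<sigma>}" "\<tau> \<in> {\<sigma>. block_monotone n b up \<sigma>}"
  then have \<sigma>: "block_monotone n b up \<sigma>" and \<tau>: "block_monotone n b up \<tau>" by simp_all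
  note ww = class_rev_involutive[OF convex_classes_mono[OF b], of n]
  note c\<sigma> = convex_classes_block_pair[OF b \<sigma>] and c\<tau> = convex_classes_block_pair[OF b \<tau>]
  have e: "\<sigma> (class_rev n (block_pair b \<sigma>) i) = \<tau> (class_rev n (block_pair b \<tau>) i)" for i
    using fun_cong[OF eq, of "class_rev n b i"] by (simp add: flip_def ww) (metis ww)
  have "b (\<sigma> i) = b (\<tau> i)" for i
    using arg_cong[OF e[of i], of b] class_rev_class[OF c\<sigma>, of i] class_rev_class[OF c\<tau>, of i]
    by (simp add: block_pair_def)
  then have "block_pair b \<sigma> = block_pair b \<tau>" by (simp add: block_pair_def fun_eq_iff)
  then show "\<sigma> = \<tau>" using e class_rev_involutive[OF c\<tau>] by (metis ext)
qed

lemma finite_involutions: "finite (involutions n)"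
  by (rule finite_subset[OF _ finite_permutations[of "{1..n}"]]) (auto simp: involutions_def)

lemma card_block_monotone_involutions:
  assumes "mono b"
  shows "card {\<sigma> \<in> involutions n. block_monotone n b True \<sigma>}
       = card {\<sigma> \<in> involutions n. block_monotone n b False \<sigma>}"
proof -
  have "card {\<sigma> \<in> involutions n. block_monotone n b up \<sigma>}
      \<le> card {\<sigma> \<in> involutions n. block_monotone n b (\<not> up) \<sigma>}" for up
  proof (rule card_inj_on_le)
    show "inj_on (flip n b) {\<sigma> \<in> involutions n. block_monotone n b up \<sigma>}"
      by (rule inj_on_subset[OF flip_inj[OF assms, of n up]]) auto
  qed (use flip_involution[OF assms] flip_monotone[OF assms] finite_involutions in auto)
  from this[of True] this[of False] show ?thesis by simp
qed

section \<open>Descent sets and ascent sets of involutions\<close>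

definition Asc :: "nat \<Rightarrow> (nat \<Rightarrow> nat) \<Rightarrow> nat set" where
  "Asc n \<sigma> = {i. 1 \<le> i \<and> i < n \<and> \<sigma> i < \<sigma> (i + 1)}"

definition block :: "nat set \<Rightarrow> nat \<Rightarrow> nat" where
  "block S i = card (S \<inter> {..<i})"

lemma mono_block: "mono (block S)"
  unfolding block_def by (intro monoI card_mono) auto

lemma block_Suc: "block S (Suc i) = block S i + (if i \<in> S then 1 else 0)"
  by (simp add: block_def lessThan_Suc)

text \<open>
  This reduces the condition on blocks to the condition on descents or ascents.
  Only neighbours need to be compared, because a block is a run of consecutive positions, and two
  neighbours \<open>i\<close> and \<open>i + 1\<close> share a block if and only if \<open>i \<notin> S\<close>.
\<close>
lemma block_monotone_iff_neighbours:
  "block_monotone n (block S) up \<sigma> \<longleftrightarrow>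
     (\<forall>i. 1 \<le> i \<and> i < n \<and> i \<notin> S \<longrightarrow> (if up then \<sigma> i < \<sigma> (Suc i) else \<sigma> (Suc i) < \<sigma> i))"
  (is "_ \<longleftrightarrow> ?N")
proof
  assume m: "block_monotone n (block S) up \<sigma>"
  show ?N
  proof (intro allI impI)
    fix i assume "1 \<le> i \<and> i < n \<and> i \<notin> S"
    then have "i \<in> {1..n}" "Suc i \<in> {1..n}" "block S i = block S (Suc i)"
      by (auto simp: block_Suc)
    with m show "if up then \<sigma> i < \<sigma> (Suc i) else \<sigma> (Suc i) < \<sigma> i"
      unfolding block_monotone_def by blast
  qed
next
  assume N: ?N
  have "if up then \<sigma> i < \<sigma> j else \<sigma> j < \<sigma> i"
    if "1 \<le> i" "i < j" "j \<le> n" "block S i = block S j" for i j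
    using that
  proof (induction j)
    case (Suc j)
    have le: "block S i \<le> block S j" "block S j \<le> block S (Suc j)"
      using Suc.prems(2) by (intro monoD[OF mono_block], linarith)+
    then have eq: "block S i = block S j" "block S j = block S (Suc j)" using Suc.prems by auto
    from eq(2) have "j \<notin> S" by (simp add: block_Suc split: if_splits)
    then have step: "if up then \<sigma> j < \<sigma> (Suc j) else \<sigma> (Suc j) < \<sigma> j" using N Suc.prems by simp
    show ?case
    proof (cases "i = j")
      case False
      then have "i < j" "j \<le> n" using Suc.prems by simp_all
      then have "if up then \<sigma> i < \<sigma> j else \<sigma> j < \<sigma> i"
        using Suc.IH Suc.prems(1) eq(1) by blast
      with step show ?thesis by (cases up) simp_all
    qed (use step in simp)
  qed simp
  then show "block_monotone n (block S) up \<sigma>" unfolding block_monotone_def by auto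
qed

lemma involution_neighbours_neq:
  assumes "\<sigma> \<in> involutions n" shows "\<sigma> i \<noteq> \<sigma> (Suc i)"
  using involutionsD(2)[OF assms] by (metis n_not_Suc_n)

lemma Des_subset_iff:
  assumes "\<sigma> \<in> involutions n"
  shows "Des n \<sigma> \<subseteq> S \<longleftrightarrow> block_monotone n (block S) True \<sigma>"
proof -
  have "\<sigma> i < \<sigma> (Suc i) \<longleftrightarrow> \<not> \<sigma> (Suc i) < \<sigma> i" for i
    using involution_neighbours_neq[OF assms, of i] by linarith
  then show ?thesis unfolding block_monotone_iff_neighbours Des_def by auto
qed

lemma Asc_subset_iff:
  assumes "\<sigma> \<in> involutions n"
  shows "Asc n \<sigma> \<subseteq> S \<longleftrightarrow> block_monotone n (block S) False \<sigma>"
proof -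
  have "\<sigma> (Suc i) < \<sigma> i \<longleftrightarrow> \<not> \<sigma> i < \<sigma> (Suc i)" for i
    using involution_neighbours_neq[OF assms, of i] by linarith
  then show ?thesis unfolding block_monotone_iff_neighbours Asc_def by auto
qed

text \<open>
  Descents contained in a set are what the blocks control; this passes from containment to equality
  by removing, inductively, the contributions of the proper subsets.
\<close>
lemma subset_sums_determine:
  fixes f g :: "'a set \<Rightarrow> nat"
  assumes "finite S" and "\<And>T. finite T \<Longrightarrow> sum f (Pow T) = sum g (Pow T)"
  shows "f S = g S"
  using assms(1)
proof (induction S rule: finite_psubset_induct)
  case (psubset S)
  have split: "sum h (Pow S) = h S + sum h (Pow S - {S})" for h :: "'a set \<Rightarrow> nat"
    using psubset.hyps by (intro sum.remove) auto
  have "sum f (Pow S - {S}) = sum g (Pow S - {S})"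
    by (rule sum.cong) (use psubset.IH in auto)
  then show ?case using assms(2)[OF psubset.hyps] by (simp add: split)
qed

lemma card_Des_eq_card_Asc:
  assumes "finite D"
  shows "card {\<sigma> \<in> involutions n. Des n \<sigma> = D} = card {\<sigma> \<in> involutions n. Asc n \<sigma> = D}"
  using assms
proof (rule subset_sums_determine)
  fix T :: "nat set" assume fin: "finite T"
  have fibres: "(\<Sum>D\<in>Pow T. card {\<sigma> \<in> involutions n. F \<sigma> = D})
      = card {\<sigma> \<in> involutions n. F \<sigma> \<subseteq> T}" for F :: "(nat \<Rightarrow> nat) \<Rightarrow> nat set"
  proof -
    have "card {\<sigma> \<in> involutions n. F \<sigma> \<subseteq> T} = card (\<Union>D\<in>Pow T. {\<sigma> \<in> involutions n. F \<sigma> = D})"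
      by (rule arg_cong[where f = card]) auto
    also have "\<dots> = (\<Sum>D\<in>Pow T. card {\<sigma> \<in> involutions n. F \<sigma> = D})"
      by (rule card_UN_disjoint) (use fin finite_involutions in auto)
    finally show ?thesis ..
  qed
  have "{\<sigma> \<in> involutions n. Des n \<sigma> \<subseteq> T} = {\<sigma> \<in> involutions n. block_monotone n (block T) True \<sigma>}"
    and "{\<sigma> \<in> involutions n. Asc n \<sigma> \<subseteq> T} = {\<sigma> \<in> involutions n. block_monotone n (block T) False \<sigma>}"
    using Des_subset_iff Asc_subset_iff by blast+
  then show "(\<Sum>D\<in>Pow T. card {\<sigma> \<in> involutions n. Des n \<sigma> = D})
      = (\<Sum>D\<in>Pow T. card {\<sigma> \<in> involutions n. Asc n \<sigma> = D})"
    unfolding fibres using card_block_monotone_involutions[OF mono_block] by simp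
qed

lemma card_Des_property_eq_card_Asc_property:
  "card {\<sigma> \<in> involutions n. P (Des n \<sigma>)} = card {\<sigma> \<in> involutions n. P (Asc n \<sigma>)}"
proof -
  let ?X = "{D \<in> Pow {1..<n}. P D}"
  have fibres: "card {\<sigma> \<in> involutions n. P (F \<sigma>)} = (\<Sum>D\<in>?X. card {\<sigma> \<in> involutions n. F \<sigma> = D})"
    if "\<And>\<sigma>. F \<sigma> \<subseteq> {1..<n}" for F :: "(nat \<Rightarrow> nat) \<Rightarrow> nat set"
  proof -
    have "card {\<sigma> \<in> involutions n. P (F \<sigma>)} = card (\<Union>D\<in>?X. {\<sigma> \<in> involutions n. F \<sigma> = D})"
      using that by (intro arg_cong[where f = card]) auto
    also have "\<dots> = (\<Sum>D\<in>?X. card {\<sigma> \<in> involutions n. F \<sigma> = D})"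
      by (rule card_UN_disjoint) (use finite_involutions in auto)
    finally show ?thesis .
  qed
  have "Des n \<sigma> \<subseteq> {1..<n}" "Asc n \<sigma> \<subseteq> {1..<n}" for \<sigma> by (auto simp: Des_def Asc_def)
  then have "card {\<sigma> \<in> involutions n. P (Des n \<sigma>)} = (\<Sum>D\<in>?X. card {\<sigma> \<in> involutions n. Des n \<sigma> = D})"
    and "card {\<sigma> \<in> involutions n. P (Asc n \<sigma>)} = (\<Sum>D\<in>?X. card {\<sigma> \<in> involutions n. Asc n \<sigma> = D})"
    by (simp_all only: fibres)
  moreover have "(\<Sum>D\<in>?X. card {\<sigma> \<in> involutions n. Des n \<sigma> = D})
      = (\<Sum>D\<in>?X. card {\<sigma> \<in> involutions n. Asc n \<sigma> = D})"
    by (intro sum.cong refl card_Des_eq_card_Asc) (auto intro: finite_subset)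
  ultimately show ?thesis by simp
qed

lemma Des_Asc_totals:
  assumes "\<sigma> \<in> involutions n"
  shows "card (Asc n \<sigma>) + des n \<sigma> = n - 1" and "\<Sum> (Asc n \<sigma>) + maj n \<sigma> = n choose 2"
proof -
  have U: "Asc n \<sigma> \<union> Des n \<sigma> = {1..<n}" and I: "Asc n \<sigma> \<inter> Des n \<sigma> = {}"
    using involution_neighbours_neq[OF assms] by (auto simp: Asc_def Des_def not_less nat_less_le)
  then have f: "finite (Asc n \<sigma>)" "finite (Des n \<sigma>)" by (metis finite_Un finite_atLeastLessThan)+
  show "card (Asc n \<sigma>) + des n \<sigma> = n - 1"
    using card_Un_disjoint[OF f I] U by (simp add: des_def)
  have "\<Sum> {1..<n} = \<Sum> {0..<n}" by (rule sum.mono_neutral_left) auto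
  also have "\<dots> = n choose 2"
    by (induction n) (simp_all add: numeral_2_eq_2)
  finally show "\<Sum> (Asc n \<sigma>) + maj n \<sigma> = n choose 2"
    using sum.union_disjoint[OF f I, of "\<lambda>i. i"] U by (simp add: maj_def)
qed

section \<open>Coefficients of the generating polynomial\<close>

lemma coeff_tq_monomial:
  "coeff_tq (var_t ^ k * var_q ^ l) i j = (if k = i \<and> l = j then 1 else 0)"
proof -
  have t: "var_t ^ k = monom 1 k" by (simp add: var_t_def monom_altdef)
  have q: "var_q ^ l = monom (monom 1 l) 0"
    by (simp add: var_q_def monom_0 monom_altdef poly_const_pow)
  show ?thesis by (simp add: coeff_tq_def t q mult_monom)
qed

lemma coeff_inv_des_maj_poly:
  "coeff_tq (inv_des_maj_poly n) i j = int (card {\<sigma> \<in> involutions n. des n \<sigma> = i \<and> maj n \<sigma> = j})"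
proof -
  have "coeff_tq (inv_des_maj_poly n) i j
      = (\<Sum>\<sigma>\<in>involutions n. coeff_tq (var_t ^ des n \<sigma> * var_q ^ maj n \<sigma>) i j)"
    by (simp add: inv_des_maj_poly_def coeff_tq_def coeff_sum)
  also have "\<dots> = (\<Sum>\<sigma>\<in>involutions n. if des n \<sigma> = i \<and> maj n \<sigma> = j then 1 else 0)"
    by (simp add: coeff_tq_monomial)
  also have "\<dots> = int (card {\<sigma> \<in> involutions n. des n \<sigma> = i \<and> maj n \<sigma> = j})"
    using finite_involutions by (simp add: sum.If_cases Int_def)
  finally show ?thesis .
qed

theorem corollary2p5:
  fixes n i j :: nat
  assumes "n \<ge> 1" and "i \<le> n - 1" and "j \<le> n choose 2"
  shows "coeff_tq (inv_des_maj_poly n) i j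
       = coeff_tq (inv_des_maj_poly n) (n - 1 - i) ((n choose 2) - j)"
proof -
  have "card {\<sigma> \<in> involutions n. des n \<sigma> = i \<and> maj n \<sigma> = j}
      = card {\<sigma> \<in> involutions n. card (Asc n \<sigma>) = i \<and> \<Sum> (Asc n \<sigma>) = j}"
    unfolding des_def maj_def by (rule card_Des_property_eq_card_Asc_property)
  also have "{\<sigma> \<in> involutions n. card (Asc n \<sigma>) = i \<and> \<Sum> (Asc n \<sigma>) = j}
      = {\<sigma> \<in> involutions n. des n \<sigma> = n - 1 - i \<and> maj n \<sigma> = (n choose 2) - j}"
  proof (rule Collect_cong, rule conj_cong[OF refl])
    fix \<sigma> assume "\<sigma> \<in> involutions n"
    from Des_Asc_totals[OF this] assms(2,3)
    show "(card (Asc n \<sigma>) = i \<and> \<Sum> (Asc n \<sigma>) = j)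
        = (des n \<sigma> = n - 1 - i \<and> maj n \<sigma> = (n choose 2) - j)" by linarith
  qed
  finally show ?thesis by (simp only: coeff_inv_des_maj_poly)
qed

end
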